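(* Let $F$ be a finite field, $\Gamma$ a nonempty set, $\varphi:\Gamma\to\Gamma$ a self-map, $\mathfrak{w}=(\mathfrak{w}_\alpha)_{\alpha\in\Gamma}\in F^\Gamma$, and let $\sigma_{\varphi,\mathfrak{w}}:F^\Gamma\to F^\Gamma$ be the weighted generalized shift $\sigma_{\varphi,\mathfrak{w}}((x_\alpha)_{\alpha\in\Gamma})=(\mathfrak{w}_\alpha x_{\varphi(\alpha)})_{\alpha\in\Gamma}$. Then the set-theoretical entropy satisfies $$\mathrm{ent}_{\mathrm{set}}(\sigma_{\varphi,\mathfrak{w}})=\begin{cases}0,&\text{if }\sigma_{\varphi,\mathfrak{w}}\text{ is quasi-periodic},\\ +\infty,&\text{otherwise.}\end{cases}$$
   Context: A self-map $f:A\to A$ is quasi-periodic if there exist $n>m\geq 1$ with $f^n=f^m$. For a nonempty set $A$, a self-map $f:A\to A$ and a finite $D\subseteq A$, let $\mathfrak{h}(f,D)=\lim_{n\to\infty}\frac{|D\cup f(D)\cup\cdots\cup f^{n-1}(D)|}{n}$ (the limit always exists). The (covariant) set-theoretical entropy of $f$ is $\mathrm{ent}_{\mathrm{set}}(f)=\sup\{\mathfrak{h}(f,D): D\subseteq A\text{ finite}\}$. It is known that $\mathrm{ent}_{\mathrm{set}}(f)=\mathsf{o}(f)$, where $\mathsf{o}(f)$ is the supremum (in $\{0,1,2,\dots\}\cup\{+\infty\}$) of $\{0\}$ together with all $n\geq1$ such that there exist $n$ pairwise disjoint one-to-one $f$-orbits in $A$; here an $f$-orbit is a sequence $\{a_k\}_{k\geq1}$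 with $f(a_k)=a_{k+1}$ for all $k\ge 1$, and it is one-to-one if its terms are pairwise distinct. *)

theory Defs
  imports Complex_Main "HOL-Library.Extended_Real"
begin

text \<open>
  The ambient set \<open>A\<close> of a self-map \<open>f : A \<rightarrow> A\<close> is the whole type \<open>'a\<close>, which is
  nonempty.
\<close>

definition quasi_periodic :: "('a \<Rightarrow> 'a) \<Rightarrow> bool" where
  "quasi_periodic f \<longleftrightarrow> (\<exists>n m. n > m \<and> m \<ge> 1 \<and> f ^^ n = f ^^ m)"

text \<open>
  For finite \<open>D\<close> the limit always exists: the increments of the cardinalities are
  natural numbers that do not increase with \<open>n\<close>. The value at \<open>n = 0\<close> is \<open>0 / 0 = 0\<close>.
\<close>

definition set_entropy_on :: "('a \<Rightarrow> 'a) \<Rightarrow> 'a set \<Rightarrow> real" where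
  "set_entropy_on f D = lim (\<lambda>n. real (card (\<Union>k<n. (f ^^ k) ` D)) / real n)"

definition ent_set :: "('a \<Rightarrow> 'a) \<Rightarrow> ereal" where
  "ent_set f = (SUP D\<in>{D. finite D}. ereal (set_entropy_on f D))"

definition weighted_shift :: "('g \<Rightarrow> 'g) \<Rightarrow> ('g \<Rightarrow> 'f::times) \<Rightarrow> ('g \<Rightarrow> 'f) \<Rightarrow> ('g \<Rightarrow> 'f)" where
  "weighted_shift \<phi> w x = (\<lambda>\<alpha>. w \<alpha> * x (\<phi> \<alpha>))"

end

theory Submission
  imports Defs "HOL-Library.Countable"
begin

text \<open>
  The \<open>k\<close>-th iterate of the shift at \<open>\<alpha>\<close> is \<open>x (\<phi>\<^sup>k \<alpha>)\<close> times the product of the weights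
  along the path \<open>\<alpha>, \<phi> \<alpha>, \<dots>, \<phi>\<^sup>k\<^sup>-\<^sup>1 \<alpha>\<close>. If the injective paths with nonzero weights have
  bounded length, then at every \<open>\<alpha>\<close> the iterates either vanish or run into a cycle of bounded
  length, whose weight is a root of unity because \<open>F\<close> is finite; so the shift is
  quasi-periodic. If such paths exist in every length, then for all \<open>k\<close>, \<open>l\<close> there is a point
  \<open>\<beta>\<close> on such a path for which \<open>\<phi>\<^sup>k \<beta>\<close> and \<open>\<phi>\<^sup>l \<beta>\<close> avoid a given finite set. The countably many
  conditions \<open>\<sigma>\<^sup>k x\<^sub>i \<noteq> \<sigma>\<^sup>l x\<^sub>j\<close> can therefore be met one after the other, each by
  prescribing values at two fresh points, which yields infinitely many disjoint one-to-one
  orbits.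
\<close>

section \<open>Entropy of general self-maps: the two extreme values\<close>

lemma set_entropy_on_eq_0:
  assumes "quasi_periodic f" "finite D"
  shows "set_entropy_on f D = 0"
proof -
  obtain n m where nm: "m < n" "f ^^ n = f ^^ m"
    using assms(1) by (auto simp: quasi_periodic_def)
  define B where "B = (\<Union>k<n. (f ^^ k) ` D)"
  \<comment> \<open>Replacing \<open>n\<close> by \<open>m\<close> lowers any exponent
    \<open>k \<ge> n\<close>, so all the unions lie in the one finite set \<open>B\<close>.\<close>
  have red: "\<exists>i<n. f ^^ k = f ^^ i" for k
  proof (induction k rule: less_induct)
    case (less k)
    show ?case
    proof (cases "k < n")
      case False
      then have "f ^^ k = f ^^ (k - n) \<circ> f ^^ n"
        by (simp flip: funpow_add)
      also have "\<dots> = f ^^ (k - n + m)"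
        by (simp add: nm funpow_add)
      finally show ?thesis
        using less[of "k - n + m"] nm False by auto
    qed auto
  qed
  have "finite B"
    using assms(2) by (auto simp: B_def)
  have le: "card (\<Union>k<N. (f ^^ k) ` D) \<le> card B" for N
  proof (rule card_mono[OF \<open>finite B\<close>], rule subsetI)
    fix y assume "y \<in> (\<Union>k<N. (f ^^ k) ` D)"
    then obtain k x where "x \<in> D" "y = (f ^^ k) x"
      by auto
    moreover obtain i where "i < n" "f ^^ k = f ^^ i"
      using red by blast
    ultimately show "y \<in> B"
      unfolding B_def by auto
  qed
  have "(\<lambda>N. real (card (\<Union>k<N. (f ^^ k) ` D)) / real N) \<longlonglongrightarrow> 0"
  proof (rule real_tendsto_sandwich[of "\<lambda>_. 0"])
    show "\<forall>\<^sub>F N in sequentially.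
        real (card (\<Union>k<N. (f ^^ k) ` D)) / real N \<le> real (card B) / real N"
      using le by (intro always_eventually allI divide_right_mono) auto
  qed (auto intro: lim_const_over_n)
  then show ?thesis
    by (simp add: set_entropy_on_def limI)
qed

lemma set_entropy_on_inj:
  fixes x :: "nat \<Rightarrow> 'a"
  assumes inj: "inj (\<lambda>(i, k). (f ^^ k) (x i))"
  shows "set_entropy_on f (x ` {..<N}) = real N"
proof -
  have card: "card (\<Union>k<n. (f ^^ k) ` x ` {..<N}) = N * n" for n
  proof -
    have "(\<Union>k<n. (f ^^ k) ` x ` {..<N}) = (\<lambda>(i, k). (f ^^ k) (x i)) ` ({..<N} \<times> {..<n})"
      by force
    also have "card \<dots> = card ({..<N} \<times> {..<n})"
      by (rule card_image) (rule inj_on_subset[OF inj], simp)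
    finally show ?thesis
      by simp
  qed
  have "(\<lambda>n. real (card (\<Union>k<n. (f ^^ k) ` x ` {..<N})) / real n) \<longlonglongrightarrow> real N"
    \<comment> \<open>The quotient at \<open>n = 0\<close> is 0 by convention; it is evaluated as
      \<open>N\<close> only for \<open>n > 0\<close>.\<close>
    by (rule tendsto_eventually)
      (use eventually_gt_at_top[of 0] in \<open>eventually_elim, simp only: card, simp\<close>)
  then show ?thesis
    by (simp add: set_entropy_on_def limI)
qed

lemma ent_set_quasi_periodic:
  assumes "quasi_periodic f"
  shows "ent_set f = 0"
proof -
  have "ent_set f = (SUP D\<in>{D :: 'a set. finite D}. 0)"
    unfolding ent_set_def using assms
    by (intro SUP_cong) (auto simp: set_entropy_on_eq_0)
  also have "\<dots> = 0"
    by (intro cSUP_const) auto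
  finally show ?thesis .
qed

lemma ent_set_eq_infinity:
  fixes x :: "nat \<Rightarrow> 'a"
  assumes "inj (\<lambda>(i, k). (f ^^ k) (x i))"
  shows "ent_set f = \<infinity>"
  unfolding ent_set_def
proof (rule SUP_PInfty)
  fix N :: nat
  show "\<exists>D\<in>{D. finite D}. ereal (real N) \<le> ereal (set_entropy_on f D)"
    by (rule bexI[of _ "x ` {..<N}"]) (simp_all add: set_entropy_on_inj[OF assms])
qed

section \<open>Greedy choice of disjoint finite sets\<close>

lemma disjoint_finite_choice:
  fixes P :: "'i::countable \<Rightarrow> 'b \<Rightarrow> bool" and s :: "'i \<Rightarrow> 'b \<Rightarrow> 'a set"
  assumes fin: "\<And>i b. finite (s i b)"
    and ex: "\<And>i S. finite S \<Longrightarrow> \<exists>b. P i b \<and> s i b \<inter> S = {}"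
  obtains b where "\<And>i. P i (b i)" "\<And>i j. i \<noteq> j \<Longrightarrow> s i (b i) \<inter> s j (b j) = {}"
proof -
  define c where "c i S = (SOME b. P i b \<and> s i b \<inter> S = {})" for i S
  have c: "P i (c i S) \<and> s i (c i S) \<inter> S = {}" if "finite S" for i S
    unfolding c_def using ex[OF that] by (rule someI_ex)
  \<comment> \<open>\<open>U n\<close> collects what the stages below \<open>n\<close> have used,
    and \<open>i\<close> is served at stage \<open>to_nat i\<close>. Stages outside the range of
    \<open>to_nat\<close> merely add further finite sets.\<close>
  define U where
    "U = rec_nat {} (\<lambda>n S. S \<union> s (from_nat n) (c (from_nat n) S))"
  have U_Suc: "U (Suc n) = U n \<union> s (from_nat n) (c (from_nat n) (U n))" for n
    by (simp add: U_def)
  have fin_U: "finite (U n)" for n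
    by (induction n) (simp_all add: U_Suc fin, simp add: U_def)
  have "mono U"
    by (rule incseq_SucI) (auto simp: U_Suc)
  define b where "b i = c i (U (to_nat i))" for i
  have later: "s i (b i) \<inter> s j (b j) = {}" if "to_nat i < to_nat j" for i j
  proof -
    have "s i (b i) \<subseteq> U (Suc (to_nat i))"
      by (simp add: U_Suc b_def)
    also have "\<dots> \<subseteq> U (to_nat j)"
      by (rule monoD[OF \<open>mono U\<close>]) (use that in simp)
    finally show ?thesis
      using c[OF fin_U, of j "to_nat j"] by (auto simp: b_def)
  qed
  show thesis
  proof
    show "P i (b i)" for i
      using c[OF fin_U] by (simp add: b_def)
    show "s i (b i) \<inter> s j (b j) = {}" if "i \<noteq> j" for i j
    proof -
      have "to_nat i < to_nat j \<or> to_nat j < to_nat i"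
        using that by (metis from_nat_to_nat linorder_neqE_nat)
      then show ?thesis
        using later[of i j] later[of j i] by auto
    qed
  qed
qed

section \<open>Bounded paths and quasi-periodicity\<close>

definition path_weight :: "('g \<Rightarrow> 'g) \<Rightarrow> ('g \<Rightarrow> 'f::comm_monoid_mult) \<Rightarrow> nat \<Rightarrow> 'g \<Rightarrow> 'f"
  where "path_weight \<phi> w k \<alpha> = (\<Prod>i<k. w ((\<phi> ^^ i) \<alpha>))"

lemma path_weight_add:
  "path_weight \<phi> w (k + l) \<alpha> = path_weight \<phi> w k \<alpha> * path_weight \<phi> w l ((\<phi> ^^ k) \<alpha>)"
proof (induction l)
  case (Suc l)
  have "(\<phi> ^^ (k + l)) \<alpha> = (\<phi> ^^ l) ((\<phi> ^^ k) \<alpha>)"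
    by (metis add.commute comp_apply funpow_add)
  with Suc show ?case
    by (simp add: path_weight_def mult.assoc)
qed (simp add: path_weight_def)

lemma weighted_shift_funpow:
  fixes w :: "'g \<Rightarrow> 'f::comm_monoid_mult"
  shows "(weighted_shift \<phi> w ^^ k) x \<alpha> = path_weight \<phi> w k \<alpha> * x ((\<phi> ^^ k) \<alpha>)"
proof (induction k arbitrary: x)
  case (Suc k)
  \<comment> \<open>The shift applied first is peeled off, so the induction hypothesis is used at
    \<open>weighted_shift \<phi> w x\<close>.\<close>
  then show ?case
    unfolding funpow_Suc_right comp_apply Suc.IH
    by (simp add: weighted_shift_def path_weight_def funpow_swap1 mult.assoc)
qed (simp add: path_weight_def)

definition nonvanishing_path :: "('g \<Rightarrow> 'g) \<Rightarrow> ('g \<Rightarrow> 'f::zero) \<Rightarrow> nat \<Rightarrow> 'g \<Rightarrow> bool"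
  where "nonvanishing_path \<phi> w M \<alpha> \<longleftrightarrow>
    inj_on (\<lambda>i. (\<phi> ^^ i) \<alpha>) {..<M} \<and> (\<forall>i<M. w ((\<phi> ^^ i) \<alpha>) \<noteq> 0)"

text \<open>By the pigeonhole principle some positive exponent up to the size of the field gives 1,
  and the factorial is a common multiple of all such exponents.\<close>

lemma finite_field_power_fact_eq_1:
  fixes c :: "'f::{field, finite}"
  assumes "c \<noteq> 0"
  shows "c ^ fact (card (UNIV :: 'f set)) = 1"
proof -
  have "\<not> inj_on (\<lambda>i. c ^ i) {..card (UNIV :: 'f set)}"
  proof
    assume "inj_on (\<lambda>i. c ^ i) {..card (UNIV :: 'f set)}"
    then have "card {..card (UNIV :: 'f set)} \<le> card (UNIV :: 'f set)"
      by (rule card_inj_on_le) auto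
    then show False
      by simp
  qed
  then obtain i j where "i < j" "j \<le> card (UNIV :: 'f set)" "c ^ i = c ^ j"
    using linorder_inj_onI'[of _ "\<lambda>i. c ^ i"] by (metis atMost_iff)
  then have "c ^ i * c ^ (j - i) = c ^ i * 1"
    by (metis le_add_diff_inverse less_imp_le mult_1_right power_add)
  with assms have "c ^ (j - i) = 1"
    by simp
  moreover have "j - i dvd fact (card (UNIV :: 'f set))"
    using \<open>i < j\<close> \<open>j \<le> card (UNIV :: 'f set)\<close> by (intro dvd_fact) auto
  ultimately show ?thesis
    by (metis dvdE power_mult power_one)
qed

lemma quasi_periodic_weighted_shift:
  fixes w :: "'g \<Rightarrow> 'f::{field, finite}"
  assumes no_path: "\<And>\<alpha>. \<not> nonvanishing_path \<phi> w M \<alpha>"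
  shows "quasi_periodic (weighted_shift \<phi> w)"
proof -
  define r :: nat where "r = fact (card (UNIV :: 'f set))"
  \<comment> \<open>One period has to serve every \<open>\<alpha>\<close>: \<open>fact M\<close> is
    a multiple of each cycle length below \<open>M\<close>, and \<open>r\<close> turns each nonzero
    cycle weight into 1.\<close>
  define L where "L = fact M * r"
  have "(weighted_shift \<phi> w ^^ (Suc M + L)) x \<alpha> = (weighted_shift \<phi> w ^^ Suc M) x \<alpha>" for x \<alpha>
  proof (cases "\<exists>i<M. w ((\<phi> ^^ i) \<alpha>) = 0")
    case True
    then have "path_weight \<phi> w k \<alpha> = 0" if "k \<ge> M" for k
      using that by (auto simp: path_weight_def intro: order_less_le_trans)
    then show ?thesis
      by (simp add: weighted_shift_funpow del: funpow.simps)
  next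
    case False
    with no_path[of \<alpha>] have "\<not> inj_on (\<lambda>i. (\<phi> ^^ i) \<alpha>) {..<M}"
      by (auto simp: nonvanishing_path_def)
    then obtain i j where ij: "i < j" "j < M" "(\<phi> ^^ i) \<alpha> = (\<phi> ^^ j) \<alpha>"
      using linorder_inj_onI'[of _ "\<lambda>i. (\<phi> ^^ i) \<alpha>"] by (metis lessThan_iff)
    define q where "q = j - i"
    define \<beta> where "\<beta> = (\<phi> ^^ i) \<alpha>"
    define c where "c = path_weight \<phi> w q \<beta>"
    have cyc: "(\<phi> ^^ q) \<beta> = \<beta>"
      by (metis \<beta>_def add.commute comp_apply funpow_add ij(1,3) le_add_diff_inverse less_imp_le q_def)
    have "c \<noteq> 0"
    proof -
      \<comment> \<open>The cycle weight \<open>c\<close> is a factor of this product, whose weights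
        all come from the first \<open>M\<close> points.\<close>
      have "path_weight \<phi> w j \<alpha> \<noteq> 0"
        using False ij by (auto simp: path_weight_def)
      then show ?thesis
        using ij path_weight_add[of \<phi> w i q \<alpha>] by (auto simp: c_def q_def \<beta>_def)
    qed
    have cyc_pow: "(\<phi> ^^ (n * q)) \<beta> = \<beta>" for n
      by (induction n) (simp_all add: funpow_add cyc)
    have weight_pow: "path_weight \<phi> w (n * q) \<beta> = c ^ n" for n
    proof (induction n)
      case (Suc n)
      then show ?case
        by (simp add: path_weight_add cyc c_def)
    qed (simp add: path_weight_def)
    have "q dvd fact M"
      using ij by (intro dvd_fact) (auto simp: q_def)
    then obtain d where d: "fact M = q * d"
      by auto
    have L: "L = d * r * q"
      by (simp add: L_def d)
    have "c ^ (d * r) = 1"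
      using finite_field_power_fact_eq_1[OF \<open>c \<noteq> 0\<close>]
      by (metis r_def mult.commute power_mult power_one)
    then have weight_L: "path_weight \<phi> w L \<beta> = 1"
      by (simp only: L weight_pow)
    have fix_L: "(\<phi> ^^ L) \<beta> = \<beta>"
      by (simp only: L cyc_pow)
    \<comment> \<open>After \<open>i\<close> steps the path is at \<open>\<beta>\<close> on the
      cycle. There \<open>L\<close> more steps change neither point nor weight, and \<open>e\<close>
      steps remain.\<close>
    define e where "e = Suc M - i"
    have e: "Suc M = i + e" "Suc M + L = i + (L + e)"
      using ij by (auto simp: e_def)
    have orbit: "(\<phi> ^^ (i + n)) \<alpha> = (\<phi> ^^ n) \<beta>" for n
      by (metis \<beta>_def add.commute comp_apply funpow_add)
    have "(\<phi> ^^ (L + e)) \<beta> = (\<phi> ^^ e) \<beta>"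
      by (metis fix_L add.commute comp_apply funpow_add)
    moreover have "path_weight \<phi> w (L + e) \<beta> = path_weight \<phi> w e \<beta>"
      by (simp add: path_weight_add weight_L fix_L)
    ultimately show ?thesis
      \<comment> \<open>\<open>e(2)\<close> comes first because \<open>e(1)\<close> would also
        rewrite the \<open>Suc M\<close> inside \<open>Suc M + L\<close>.\<close>
      unfolding e(2) unfolding e(1) weighted_shift_funpow orbit path_weight_add[of \<phi> w i]
        \<beta>_def[symmetric]
      by simp
  qed
  then have "weighted_shift \<phi> w ^^ (Suc M + L) = weighted_shift \<phi> w ^^ Suc M"
    by (intro ext)
  moreover have "L > 0"
    by (simp add: L_def r_def)
  ultimately show ?thesis
    unfolding quasi_periodic_def by (intro exI[of _ "Suc M + L"] exI[of _ "Suc M"]) simp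
qed

section \<open>Disjoint orbits from arbitrarily long paths\<close>

lemma fresh_point:
  fixes w :: "'g \<Rightarrow> 'f::field"
  assumes paths: "\<And>M. \<exists>\<alpha>. nonvanishing_path \<phi> w M \<alpha>" and "finite S"
  obtains \<beta> where "path_weight \<phi> w k \<beta> \<noteq> 0" "path_weight \<phi> w l \<beta> \<noteq> 0"
    "k \<noteq> l \<Longrightarrow> (\<phi> ^^ k) \<beta> \<noteq> (\<phi> ^^ l) \<beta>" "(\<phi> ^^ k) \<beta> \<notin> S" "(\<phi> ^^ l) \<beta> \<notin> S"
proof -
  \<comment> \<open>As the path is injective, each of the shifts by \<open>k\<close> and
    \<open>l\<close> sends at most \<open>card S\<close> starting indices into \<open>S\<close>, so
    one of \<open>R\<close> indices survives both. The length \<open>M\<close> keeps all these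
    shifted points on the path.\<close>
  define R where "R = Suc (2 * card S)"
  define M where "M = R + k + l"
  obtain \<alpha> where \<alpha>: "nonvanishing_path \<phi> w M \<alpha>"
    using paths by blast
  then have inj: "inj_on (\<lambda>i. (\<phi> ^^ i) \<alpha>) {..<M}" and nz: "\<And>i. i < M \<Longrightarrow> w ((\<phi> ^^ i) \<alpha>) \<noteq> 0"
    by (auto simp: nonvanishing_path_def)
  define B where "B n = {i. i < R \<and> (\<phi> ^^ (n + i)) \<alpha> \<in> S}" for n
  have card_B: "card (B n) \<le> card S" if "n + R \<le> M" for n
  proof (rule card_inj_on_le)
    show "inj_on (\<lambda>i. (\<phi> ^^ (n + i)) \<alpha>) (B n)"
    proof (rule inj_onI)
      fix i j assume "i \<in> B n" "j \<in> B n" "(\<phi> ^^ (n + i)) \<alpha> = (\<phi> ^^ (n + j)) \<alpha>"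
      then show "i = j"
        using inj_onD[OF inj, of "n + i" "n + j"] that by (simp add: B_def)
    qed
  qed (auto simp: B_def \<open>finite S\<close>)
  have "card (B k \<union> B l) \<le> card (B k) + card (B l)"
    by (rule card_Un_le)
  also have "\<dots> < card {..<R}"
    using card_B[of k] card_B[of l] by (simp add: M_def R_def)
  finally have less: "card (B k \<union> B l) < card {..<R}" .
  have "\<not> {..<R} \<subseteq> B k \<union> B l"
  proof
    assume "{..<R} \<subseteq> B k \<union> B l"
    then have "card {..<R} \<le> card (B k \<union> B l)"
      by (rule card_mono[rotated]) (simp add: B_def)
    with less show False
      by simp
  qed
  then obtain i where i: "i < R" "i \<notin> B k" "i \<notin> B l"
    by auto
  have shift: "(\<phi> ^^ n) ((\<phi> ^^ i) \<alpha>) = (\<phi> ^^ (n + i)) \<alpha>" for n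
    by (simp add: funpow_add)
  show thesis
  proof (rule that[of "(\<phi> ^^ i) \<alpha>"])
    show "path_weight \<phi> w k ((\<phi> ^^ i) \<alpha>) \<noteq> 0" "path_weight \<phi> w l ((\<phi> ^^ i) \<alpha>) \<noteq> 0"
      using i nz by (auto simp: path_weight_def shift M_def)
    show "(\<phi> ^^ k) ((\<phi> ^^ i) \<alpha>) \<noteq> (\<phi> ^^ l) ((\<phi> ^^ i) \<alpha>)" if "k \<noteq> l"
      using inj_onD[OF inj, of "k + i" "l + i"] i that by (auto simp: shift M_def)
    show "(\<phi> ^^ k) ((\<phi> ^^ i) \<alpha>) \<notin> S" "(\<phi> ^^ l) ((\<phi> ^^ i) \<alpha>) \<notin> S"
      using i by (auto simp: shift B_def)
  qed
qed

text \<open>The point chosen for the index \<open>((i, k), (j, l))\<close> is where the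
  \<open>k\<close>-th iterate of \<open>x i\<close> is to differ from the \<open>l\<close>-th
  iterate of \<open>x j\<close>.\<close>

lemma disjoint_injective_orbits:
  fixes w :: "'g \<Rightarrow> 'f::field"
  assumes paths: "\<And>M. \<exists>\<alpha>. nonvanishing_path \<phi> w M \<alpha>"
  obtains x :: "nat \<Rightarrow> 'g \<Rightarrow> 'f" where "inj (\<lambda>(i, k). (weighted_shift \<phi> w ^^ k) (x i))"
proof -
  \<comment> \<open>Distinctness is conditional since indices with \<open>k = l\<close> occur as
    well.\<close>
  define P where "P = (\<lambda>((i :: nat, k), (j :: nat, l)) \<beta>. path_weight \<phi> w k \<beta> \<noteq> 0 \<and>
    path_weight \<phi> w l \<beta> \<noteq> 0 \<and> (k \<noteq> l \<longrightarrow> (\<phi> ^^ k) \<beta> \<noteq> (\<phi> ^^ l) \<beta>))"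
  define s where "s = (\<lambda>((i :: nat, k), (j :: nat, l)) \<beta>. {(\<phi> ^^ k) \<beta>, (\<phi> ^^ l) \<beta>})"
  have "finite (s p \<beta>)" for p \<beta>
    by (auto simp: s_def split: prod.split)
  moreover have "\<exists>\<beta>. P p \<beta> \<and> s p \<beta> \<inter> S = {}" if "finite S" for p S
  proof -
    obtain i k j l where p: "p = ((i, k), (j, l))"
      by (metis surj_pair)
    show ?thesis
      by (rule fresh_point[OF paths that, of k l]) (auto simp: p P_def s_def)
  qed
  ultimately obtain b where P_b: "\<And>p. P p (b p)"
    and disj: "\<And>p q. p \<noteq> q \<Longrightarrow> s p (b p) \<inter> s q (b q) = {}"
    by (rule disjoint_finite_choice[of s P]) blast+
  define x :: "nat \<Rightarrow> 'g \<Rightarrow> 'f" where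
    "x i \<gamma> = (if \<exists>k q. \<gamma> = (\<phi> ^^ k) (b ((i, k), q)) then 1 else 0)" for i \<gamma>
  have "(weighted_shift \<phi> w ^^ k) (x i) \<noteq> (weighted_shift \<phi> w ^^ l) (x j)"
    if ne: "(i, k) \<noteq> (j, l)" for i k j l
  proof -
    define p where "p = ((i, k), (j, l))"
    have P: "path_weight \<phi> w k (b p) \<noteq> 0" "path_weight \<phi> w l (b p) \<noteq> 0"
      "k \<noteq> l \<Longrightarrow> (\<phi> ^^ k) (b p) \<noteq> (\<phi> ^^ l) (b p)"
      using P_b[of p] by (auto simp: P_def p_def)
    have "x i ((\<phi> ^^ k) (b p)) = 1"
      by (auto simp: x_def p_def)
    moreover have "x j ((\<phi> ^^ l) (b p)) = 0"
    proof -
      have False if eq: "(\<phi> ^^ l) (b p) = (\<phi> ^^ k') (b ((j, k'), q))" for k' q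
      proof -
        have "(\<phi> ^^ l) (b p) \<in> s p (b p)"
          by (simp add: s_def p_def)
        moreover have "(\<phi> ^^ l) (b p) \<in> s ((j, k'), q) (b ((j, k'), q))"
          by (simp add: s_def eq split: prod.split)
        ultimately have "p = ((j, k'), q)"
          using disj by blast
        \<comment> \<open>Now \<open>i = j\<close> and \<open>k = k'\<close>, so \<open>ne\<close>
          gives \<open>k \<noteq> l\<close>, while \<open>eq\<close> identifies the two points that
          \<open>P(3)\<close> separates.\<close>
        with eq ne P(3) show False
          by (auto simp: p_def)
      qed
      then show ?thesis
        by (auto simp: x_def)
    qed
    \<comment> \<open>The left side is a nonzero path weight and the right side is 0.\<close>
    ultimately have "(weighted_shift \<phi> w ^^ k) (x i) (b p) \<noteq> (weighted_shift \<phi> w ^^ l) (x j) (b p)"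
      using P by (simp add: weighted_shift_funpow)
    then show ?thesis
      by metis
  qed
  then have "inj (\<lambda>(i, k). (weighted_shift \<phi> w ^^ k) (x i))"
    by (intro injI) (auto split: prod.splits)
  then show thesis
    by (rule that)
qed

theorem theorem3p4:
  fixes \<phi> :: "'g \<Rightarrow> 'g"
    and w :: "'g \<Rightarrow> 'f::{field, finite}"
  shows "ent_set (weighted_shift \<phi> w) =
    (if quasi_periodic (weighted_shift \<phi> w) then 0 else \<infinity>)"
proof (cases "quasi_periodic (weighted_shift \<phi> w)")
  case False
  then have "\<exists>\<alpha>. nonvanishing_path \<phi> w M \<alpha>" for M
    using quasi_periodic_weighted_shift[of \<phi> w M] by blast
  then obtain x :: "nat \<Rightarrow> 'g \<Rightarrow> 'f" where "inj (\<lambda>(i, k). (weighted_shift \<phi> w ^^ k) (x i))"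
    by (rule disjoint_injective_orbits)
  with False show ?thesis
    by (simp add: ent_set_eq_infinity)
qed (simp add: ent_set_quasi_periodic)

end
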